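(* Let $D\subseteq\mathbb{C}$ be open, let $\varphi_2$ be a polynomial of degree $3$, let $\varphi_1$ be a non-constant analytic function on $D$, let $\alpha,\beta\in\mathbb{R}^{+}\setminus\{1\}$, and for $n=0,1,2,\dots$ let $\Theta_n(x)=\alpha^{\varphi_1(x)}\frac{d^n}{dx^n}\beta^{-\varphi_2(x)}$. Then for each $n\ge 0$ the function $y=\Theta_n(x)$ satisfies on $D$ the third order linear differential equation $$y'''+\left\{\ln\beta\,\varphi_2'(x)-3\ln\alpha\,\varphi_1'(x)\right\}y''$$ $$+\left\{(n+2)\ln\beta\,\varphi_2''(x)-3\ln\alpha\,\varphi_1''(x)-2\ln\alpha\ln\beta\,\varphi_1'(x)\varphi_2'(x)+3(\ln\alpha)^2(\varphi_1'(x))^2\right\}y'$$ $$+\Big\{-(\ln\alpha)^3(\varphi_1'(x))^3+(\ln\alpha)^2\ln\beta\,\varphi_2'(x)(\varphi_1'(x))^2+3(\ln\alpha)^2\varphi_1'(x)\varphi_1''(x)-\ln\alpha\,\varphi_1'''(x)-\ln\alpha\ln\beta\,\varphi_1''(x)\varphi_2'(x)$$ $$-(n+2)\ln\alpha\ln\beta\,\varphi_2''(x)\varphi_1'(x)+\tfrac12(n+1)(n+2)\ln\beta\,\varphi_2'''(x)\Big\}y=0.$$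
   Context: For $c>0$ and $w\in\mathbb{C}$, $c^{w}=e^{w\ln c}$ with $\ln$ the real natural logarithm. Primes denote derivatives with respect to $x$. *)

theory Defs
  imports "HOL-Complex_Analysis.Complex_Analysis"
begin

definition Theta ::
    "real \<Rightarrow> real \<Rightarrow> (complex \<Rightarrow> complex) \<Rightarrow> (complex \<Rightarrow> complex) \<Rightarrow> nat \<Rightarrow> complex \<Rightarrow> complex"
  where "Theta \<alpha> \<beta> \<phi>1 \<phi>2 n x =
    of_real \<alpha> powr \<phi>1 x * (deriv ^^ n) (\<lambda>z. of_real \<beta> powr (- \<phi>2 z)) x"

text \<open>For a positive real base, complex \<open>powr\<close> (defined through the principal branch of the
  complex logarithm) is the power formed with the real natural logarithm.\<close>

lemma of_real_powr_eq_exp_ln: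
  fixes c :: real and w :: complex
  assumes "c > 0"
  shows "of_real c powr w = exp (w * of_real (ln c))"
  using assms by (simp add: powr_def Ln_of_real)

end

theory Submission
  imports Defs
begin

text \<open>
  Let $g = \beta^{-\varphi_2}$. Applying Leibniz' rule to the $(n+2)$-nd derivative of
  $g' = -\ln\beta\,\varphi_2'\,g$ gives only three terms, as $\varphi_2'$ is quadratic; this is a
  third order linear equation for $g^{(n)}$. Substituting $g^{(n)} = \alpha^{-\varphi_1} y$ turns
  it into the equation for $y$.
\<close>

text \<open>Leibniz' rule applied to (e^f)' = f' e^f. The result is a recursion giving each
  derivative of e^f in terms of lower ones; it serves both the power of \<beta>, where the exponent
  is a cubic polynomial, and the power of \<alpha>, where it is only holomorphic on an open
  set.\<close>

lemma higher_deriv_Suc_exp: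
  fixes f :: "complex \<Rightarrow> complex"
  assumes f: "f holomorphic_on S" and S: "open S" and z: "z \<in> S"
  shows "(deriv ^^ Suc n) (\<lambda>w. exp (f w)) z =
    (\<Sum>i=0..n. of_nat (n choose i) * (deriv ^^ Suc i) f z * (deriv ^^ (n - i)) (\<lambda>w. exp (f w)) z)"
proof -
  have deriv_exp: "deriv (\<lambda>w. exp (f w)) w = deriv f w * exp (f w)" if "w \<in> S" for w
  proof (rule DERIV_imp_deriv)
    have "(f has_field_derivative deriv f w) (at w)"
      using f S that by (rule holomorphic_derivI)
    then show "((\<lambda>w. exp (f w)) has_field_derivative deriv f w * exp (f w)) (at w)"
      by (auto intro!: derivative_eq_intros)
  qed
  have hol: "deriv f holomorphic_on S" "(\<lambda>w. exp (f w)) holomorphic_on S"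
    using f S by (auto intro!: holomorphic_intros)
  have "(deriv ^^ Suc n) (\<lambda>w. exp (f w)) z = (deriv ^^ n) (deriv (\<lambda>w. exp (f w))) z"
    by (simp add: funpow_Suc_right del: funpow.simps)
  also have "\<dots> = (deriv ^^ n) (\<lambda>w. deriv f w * exp (f w)) z"
  proof (rule higher_deriv_transform_within_open[OF _ _ S z])
    show "deriv (\<lambda>w. exp (f w)) holomorphic_on S"
      using hol(2) S by (rule holomorphic_deriv)
    show "(\<lambda>w. deriv f w * exp (f w)) holomorphic_on S"
      using hol by (rule holomorphic_on_mult)
  qed (rule deriv_exp)
  also have "\<dots> = (\<Sum>i=0..n. of_nat (n choose i) * (deriv ^^ i) (deriv f) z
      * (deriv ^^ (n - i)) (\<lambda>w. exp (f w)) z)"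
    by (rule higher_deriv_mult[OF hol S z])
  finally show ?thesis
    by (simp add: funpow_Suc_right del: funpow.simps)
qed

lemma higher_deriv_poly:
  fixes p :: "'a::real_normed_field poly"
  shows "(deriv ^^ n) (poly p) = poly ((pderiv ^^ n) p)"
proof (induction n)
  case (Suc n)
  then show ?case
    by (auto intro!: DERIV_imp_deriv poly_DERIV)
qed simp

lemma higher_deriv_poly_eq_0:
  fixes p :: "'a::real_normed_field poly"
  assumes "degree p < n"
  shows "(deriv ^^ n) (poly p) z = 0"
proof -
  have "(pderiv ^^ n) p = 0"
    using assms by (intro poly_eqI) (simp add: coeff_higher_pderiv coeff_eq_0)
  then show ?thesis
    by (simp add: higher_deriv_poly)
qed

text \<open>In the recursion of order n + 3 the i-th term carries the derivative of \<open>p\<close>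
  of order i + 1, which vanishes for i > 2. The three surviving binomials 1, n + 2 and (n + 1)(n +
  2)/2 are the source of the n-dependent coefficients in the final equation.\<close>

lemma higher_deriv_exp_cubic:
  fixes p :: "complex poly"
  assumes "degree p \<le> 3"
  defines "g \<equiv> \<lambda>w. exp (poly p w)"
  shows "(deriv ^^ (n + 3)) g z = deriv (poly p) z * (deriv ^^ (n + 2)) g z
    + (of_nat n + 2) * (deriv ^^ 2) (poly p) z * (deriv ^^ (n + 1)) g z
    + (of_nat n + 1) * (of_nat n + 2) / 2 * (deriv ^^ 3) (poly p) z * (deriv ^^ n) g z"
proof -
  let ?t = "\<lambda>i. of_nat (n + 2 choose i) * (deriv ^^ Suc i) (poly p) z * (deriv ^^ (n + 2 - i)) g z"
  have "(deriv ^^ (n + 3)) g z = (\<Sum>i=0..n+2. ?t i)"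
    using higher_deriv_Suc_exp[of "poly p" UNIV z "n + 2"]
    by (simp add: g_def numeral_3_eq_3 holomorphic_intros del: funpow.simps)
  also have "\<dots> = (\<Sum>i\<in>{0,1,2}. ?t i)"
  proof (rule sum.mono_neutral_right)
    show "\<forall>i\<in>{0..n + 2} - {0, 1, 2}. ?t i = 0"
      using assms(1) by (auto simp del: funpow.simps intro!: higher_deriv_poly_eq_0)
  qed auto
  also have "\<dots> = ?t 0 + ?t 1 + ?t 2"
    by (simp del: funpow.simps)
  also have "of_nat (n + 2 choose 2) = ((of_nat n + 1) * (of_nat n + 2) / 2 :: complex)"
  proof -
    \<comment> \<open>Doubling removes the truncating division on naturals before the cast to
      complex numbers.\<close>
    have "2 * (n + 2 choose 2) = (n + 1) * (n + 2)"
      by (simp add: choose_two)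
    then have "of_nat (2 * (n + 2 choose 2)) = (of_nat ((n + 1) * (n + 2)) :: complex)"
      by simp
    then show ?thesis
      by (simp add: field_simps)
  qed
  finally show ?thesis
    by (simp add: numeral_3_eq_3 numeral_2_eq_2 algebra_simps)
qed

theorem theorem6:
  fixes D :: "complex set" and \<phi>1 :: "complex \<Rightarrow> complex" and \<phi>2 :: "complex poly"
    and \<alpha> \<beta> :: real and n :: nat
  assumes "open D"
    and "degree \<phi>2 = 3"
    and "\<phi>1 analytic_on D"
    and "\<not> \<phi>1 constant_on D"
    and "\<alpha> > 0" and "\<alpha> \<noteq> 1"
    and "\<beta> > 0" and "\<beta> \<noteq> 1"
  defines "y \<equiv> Theta \<alpha> \<beta> \<phi>1 (poly \<phi>2) n"
    and "a \<equiv> complex_of_real (ln \<alpha>)"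
    and "b \<equiv> complex_of_real (ln \<beta>)"
  shows "y holomorphic_on D \<and>
    (\<forall>x\<in>D.
      (deriv ^^ 3) y x
      + (b * deriv (poly \<phi>2) x - 3 * a * deriv \<phi>1 x) * (deriv ^^ 2) y x
      + ((of_nat n + 2) * b * (deriv ^^ 2) (poly \<phi>2) x
         - 3 * a * (deriv ^^ 2) \<phi>1 x
         - 2 * a * b * deriv \<phi>1 x * deriv (poly \<phi>2) x
         + 3 * a ^ 2 * (deriv \<phi>1 x) ^ 2) * deriv y x
      + (- (a ^ 3) * (deriv \<phi>1 x) ^ 3
         + a ^ 2 * b * deriv (poly \<phi>2) x * (deriv \<phi>1 x) ^ 2
         + 3 * a ^ 2 * deriv \<phi>1 x * (deriv ^^ 2) \<phi>1 x
         - a * (deriv ^^ 3) \<phi>1 x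
         - a * b * (deriv ^^ 2) \<phi>1 x * deriv (poly \<phi>2) x
         - (of_nat n + 2) * a * b * (deriv ^^ 2) (poly \<phi>2) x * deriv \<phi>1 x
         + (1 / 2) * (of_nat n + 1) * (of_nat n + 2) * b * (deriv ^^ 3) (poly \<phi>2) x) * y x
      = 0)"
proof -
  \<comment> \<open>Here \<open>E\<close> is \<alpha> to the power \<open>\<phi>1\<close> and
    \<open>g\<close> is \<beta> to the power \<open>- \<phi>2\<close>, so that
    \<open>y = E * u\<close>. The exponent of \<open>g\<close> is kept as a polynomial so that
    \<open>higher_deriv_exp_cubic\<close> applies.\<close>
  define E where "E = (\<lambda>w. exp (a * \<phi>1 w))"
  define g where "g = (\<lambda>w. exp (poly (smult (- b) \<phi>2) w))"
  define u where "u = (deriv ^^ n) g"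
  have \<phi>1: "\<phi>1 holomorphic_on D"
    using assms(3) by (rule analytic_imp_holomorphic)
  have a\<phi>1: "(\<lambda>w. a * \<phi>1 w) holomorphic_on D"
    using \<phi>1 by (intro holomorphic_intros)
  have E: "E holomorphic_on D"
    unfolding E_def using \<phi>1 by (intro holomorphic_intros)
  have "g holomorphic_on UNIV"
    unfolding g_def by (intro holomorphic_intros)
  then have u: "u holomorphic_on D"
    unfolding u_def by (meson holomorphic_higher_deriv holomorphic_on_subset open_UNIV subset_UNIV)
  have y_eq: "y = (\<lambda>w. E w * u w)"
    using assms(5,7)
    by (simp add: y_def Theta_def E_def u_def g_def a_def b_def of_real_powr_eq_exp_ln
        fun_eq_iff mult.commute)
  have deriv_u: "(deriv ^^ k) u = (deriv ^^ (n + k)) g" for k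
    by (simp add: u_def funpow_add add.commute[of n])
  have deriv_p: "(deriv ^^ k) (poly (smult (- b) \<phi>2)) z = - b * (deriv ^^ k) (poly \<phi>2) z" for k z
    by (simp add: higher_deriv_poly higher_pderiv_smult del: smult_minus_left)
  show ?thesis
  proof (intro conjI ballI)
    \<comment> \<open>As \<open>deriv\<close> is total, this is what ensures that the iterated
      \<open>deriv\<close> of \<open>y\<close> in the equation are genuine derivatives.\<close>
    show "y holomorphic_on D"
      unfolding y_eq using E u by (rule holomorphic_on_mult)
  next
    fix x assume x: "x \<in> D"
    have u3: "(deriv ^^ 3) u x = - b * (deriv (poly \<phi>2) x * (deriv ^^ 2) u x
        + (of_nat n + 2) * (deriv ^^ 2) (poly \<phi>2) x * deriv u x
        + (of_nat n + 1) * (of_nat n + 2) / 2 * (deriv ^^ 3) (poly \<phi>2) x * u x)"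
    proof -
      have "degree (smult (- b) \<phi>2) \<le> 3"
        using assms(2) by (simp add: degree_smult_le order_trans)
      note u3 = higher_deriv_exp_cubic[OF this, of n x, folded g_def deriv_u u_def]
      \<comment> \<open>The first-order terms are treated apart: a bare \<open>deriv\<close> does
        not match the pattern of \<open>deriv_p\<close>, and folding \<open>deriv_u\<close> leaves
        \<open>deriv ^^ 1\<close>.\<close>
      have "deriv (poly (smult (- b) \<phi>2)) x = - b * deriv (poly \<phi>2) x"
        "(deriv ^^ 1) u = deriv u"
        using deriv_p[of 1 x] by simp_all
      then show ?thesis
        unfolding u3 deriv_p by (simp add: algebra_simps del: smult_minus_left)
    qed
    have deriv_a\<phi>1: "(deriv ^^ k) (\<lambda>w. a * \<phi>1 w) x = a * (deriv ^^ k) \<phi>1 x" for k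
      using \<phi>1 assms(1) x by (intro higher_deriv_cmult)
    note deriv_E = higher_deriv_Suc_exp[OF a\<phi>1 assms(1) x, folded E_def, unfolded deriv_a\<phi>1]
    \<comment> \<open>Each instance of the recursion involves only lower derivatives of
      \<open>E\<close>, so the first three come out successively as multiples of
      \<open>E x\<close>.\<close>
    have E1: "deriv E x = a * deriv \<phi>1 x * E x"
      using deriv_E[of 0] by simp
    have E2: "(deriv ^^ 2) E x = (a * (deriv ^^ 2) \<phi>1 x + (a * deriv \<phi>1 x)\<^sup>2) * E x"
      using deriv_E[of 1] by (simp add: E1 numeral_2_eq_2 algebra_simps)
    have E3: "(deriv ^^ 3) E x = (a * (deriv ^^ 3) \<phi>1 x
        + 3 * a\<^sup>2 * deriv \<phi>1 x * (deriv ^^ 2) \<phi>1 x + (a * deriv \<phi>1 x) ^ 3) * E x"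
      using deriv_E[of 2] E1 E2
      by (simp add: numeral_2_eq_2 numeral_3_eq_3 algebra_simps)
    note deriv_y = higher_deriv_mult[OF E u assms(1) x, folded y_eq]
    have y1: "deriv y x = E x * deriv u x + deriv E x * u x"
      using deriv_y[of 1] by simp
    have y2: "(deriv ^^ 2) y x =
        E x * (deriv ^^ 2) u x + 2 * deriv E x * deriv u x + (deriv ^^ 2) E x * u x"
      using deriv_y[of 2] by (simp add: numeral_2_eq_2)
    have y3: "(deriv ^^ 3) y x = E x * (deriv ^^ 3) u x + 3 * deriv E x * (deriv ^^ 2) u x
        + 3 * (deriv ^^ 2) E x * deriv u x + (deriv ^^ 3) E x * u x"
      using deriv_y[of 3] by (simp add: numeral_2_eq_2 numeral_3_eq_3)
    have y0: "y x = E x * u x"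
      by (simp add: y_eq)
    show "(deriv ^^ 3) y x
      + (b * deriv (poly \<phi>2) x - 3 * a * deriv \<phi>1 x) * (deriv ^^ 2) y x
      + ((of_nat n + 2) * b * (deriv ^^ 2) (poly \<phi>2) x
         - 3 * a * (deriv ^^ 2) \<phi>1 x
         - 2 * a * b * deriv \<phi>1 x * deriv (poly \<phi>2) x
         + 3 * a ^ 2 * (deriv \<phi>1 x) ^ 2) * deriv y x
      + (- (a ^ 3) * (deriv \<phi>1 x) ^ 3
         + a ^ 2 * b * deriv (poly \<phi>2) x * (deriv \<phi>1 x) ^ 2
         + 3 * a ^ 2 * deriv \<phi>1 x * (deriv ^^ 2) \<phi>1 x
         - a * (deriv ^^ 3) \<phi>1 x
         - a * b * (deriv ^^ 2) \<phi>1 x * deriv (poly \<phi>2) x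
         - (of_nat n + 2) * a * b * (deriv ^^ 2) (poly \<phi>2) x * deriv \<phi>1 x
         + (1 / 2) * (of_nat n + 1) * (of_nat n + 2) * b * (deriv ^^ 3) (poly \<phi>2) x) * y x
      = 0"
      \<comment> \<open>With the third derivative of \<open>u\<close> eliminated, \<open>E x\<close>
        is a common factor and the coefficients of \<open>u\<close>, \<open>u'\<close> and
        \<open>u''\<close> cancel identically, as polynomials in \<open>a\<close>, \<open>b\<close>,
        \<open>n\<close> and the derivatives of \<open>\<phi>1\<close> and \<open>\<phi>2\<close> at
        \<open>x\<close>.\<close>
      unfolding y0 y1 y2 y3 u3 E1 E2 E3
      by (simp add: field_simps power2_eq_square power3_eq_cube)
  qed
qed

end
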